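(* Let $C$ be a field of characteristic $p>0$, $D$ a central division algebra over $C$ of degree $n$ (with $D=C$ allowed), $\delta\neq 0$ a derivation of $D$ and $F=\{a\in C : \delta(a)=0\}$. Suppose $\delta|_C$ is algebraic over $F$ with minimum polynomial $g(t)=t^{p^e}+a_1t^{p^{e-1}}+\dots+a_et\in F[t]$, where $p^e\geq 2$. Let $V:C\to F$ be the additive homomorphism $V(a)=V_{p^e}(a)+a_1V_{p^{e-1}}(a)+\dots+a_ea$. Let $d\in D$ and $f(t)=g(t)-d\in D[t;\delta]$. Then $${\rm ker}(V)=\{a\in C : V(a)=0\}=\{\delta(c)/c : c\in C,\ c\neq 0\}$$ is isomorphic, as a group, to the subgroup $\{G_{id,-a} : a\in C \text{ with } V(a)=0\}$ of ${\rm Aut}_F(S_f)$.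
   Context: $D[t;\delta]$ is the differential polynomial ring: polynomials $\sum a_it^i$ with left coefficients $a_i\in D$, termwise addition, and multiplication determined by $ta=at+\delta(a)$ for $a\in D$. It has right division: for all $h,f$ with $f\neq 0$ there are unique $q,r$ with $h=qf+r$ and $\deg r<\deg f$; write $r=h \bmod_r f$. For monic $f\in D[t;\delta]$ of degree $m\ge 2$, the Petit algebra $S_f=D[t;\delta]/D[t;\delta]f$ is the $F$-vector space $\{h\in D[t;\delta] : \deg h<m\}$ with multiplication $h\circ k = hk \bmod_r f$; it is a unital, not necessarily associative $F$-algebra. For $b\in D$, $V_{p^j}(b)\in D$ is defined by $(t-b)^{p^j}=t^{p^j}-V_{p^j}(b)$ in $D[t;\delta]$ (always of this form in characteristic $p$); $V_{p^j}$ is the $j$-fold iterate of $V_p$. For $a\in C$, $G_{id,-a}$ denotes the map $\sum a_it^i\mapsto\sum a_i(t-a)^i$ (on $D[t;\delta]$, and the induced map on $S_f$). *)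

theory Defs
  imports
    "HOL-Computational_Algebra.Computational_Algebra"
    "HOL-Algebra.Bij"
    "HOL-Algebra.Coset"
begin

text \<open>
  A central division algebra of degree \<open>n\<close> over the field \<open>'c\<close>. The field is identified with its
  image in the algebra, which has to be the whole centre. The library's \<open>dim\<close> is \<open>0\<close> for spaces
  without a finite basis, so \<open>n > 0\<close> also forces finite dimension.
\<close>

locale central_division_algebra = vector_space scale
  for scale :: "'c::field \<Rightarrow> 'd::division_ring \<Rightarrow> 'd" +
  fixes n :: nat
  assumes scale_mult_left: "scale c (x * y) = scale c x * y"
    and scale_mult_right: "scale c (x * y) = x * scale c y"
    and central: "range (\<lambda>c. scale c 1) = {z. \<forall>x. z * x = x * z}"
    and degree_pos: "n > 0"
    and dim_eq_degree_sq: "dim UNIV = n\<^sup>2"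

definition derivation :: "('d::ring \<Rightarrow> 'd) \<Rightarrow> bool" where
  "derivation \<delta> \<longleftrightarrow>
     (\<forall>x y. \<delta> (x + y) = \<delta> x + \<delta> y) \<and> (\<forall>x y. \<delta> (x * y) = \<delta> x * y + x * \<delta> y)"

definition is_min_poly_on :: "'d::division_ring set \<Rightarrow> 'd set \<Rightarrow> ('d \<Rightarrow> 'd) \<Rightarrow> 'd poly \<Rightarrow> bool" where
  "is_min_poly_on F C \<delta> g \<longleftrightarrow>
     (let ann = (\<lambda>h. (\<forall>i. coeff h i \<in> F) \<and>
                   (\<forall>c\<in>C. (\<Sum>i\<le>degree h. coeff h i * (\<delta> ^^ i) c) = 0))
      in lead_coeff g = 1 \<and> ann g \<and> (\<forall>h. h \<noteq> 0 \<and> ann h \<longrightarrow> degree g \<le> degree h))"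

text \<open>
  Elements of \<open>D[t;\<delta>]\<close> are represented by their left coefficients as values of type \<open>'d poly\<close>;
  the library's multiplication on that type is not available for noncommutative \<open>'d\<close>. Left
  multiplication by \<open>t\<close> sends \<open>\<Sum> b\<^sub>j t\<^sup>j\<close> to \<open>\<Sum> (b\<^sub>j t\<^sup>j\<^sup>+\<^sup>1 + \<delta>(b\<^sub>j) t\<^sup>j)\<close>, as forced by
  \<open>t b = b t + \<delta>(b)\<close>, and \<open>(\<Sum> a\<^sub>i t\<^sup>i) q = \<Sum> a\<^sub>i (t (\<dots> (t q)))\<close>.
\<close>

definition lsmult :: "'d::division_ring \<Rightarrow> 'd poly \<Rightarrow> 'd poly" where
  "lsmult c q = map_poly (\<lambda>x. c * x) q"

definition t_mult :: "('d::division_ring \<Rightarrow> 'd) \<Rightarrow> 'd poly \<Rightarrow> 'd poly" where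
  "t_mult \<delta> q = pCons 0 q + map_poly \<delta> q"

definition diff_mult :: "('d::division_ring \<Rightarrow> 'd) \<Rightarrow> 'd poly \<Rightarrow> 'd poly \<Rightarrow> 'd poly" where
  "diff_mult \<delta> h k = (\<Sum>i\<le>degree h. lsmult (coeff h i) ((t_mult \<delta> ^^ i) k))"

lemma diff_mult_t_const:
  assumes "derivation \<delta>"
  shows "diff_mult \<delta> [:0, 1:] [:a:] = [:\<delta> a, a:]"
proof -
  have [simp]: "\<delta> 0 = 0"
    using assms unfolding derivation_def by (metis add_cancel_right_right)
  have "degree [:0, 1::'a:] = 1" by simp
  then show ?thesis
    by (simp add: diff_mult_def lsmult_def t_mult_def map_poly_pCons)
qed

definition diff_power :: "('d::division_ring \<Rightarrow> 'd) \<Rightarrow> 'd poly \<Rightarrow> nat \<Rightarrow> 'd poly" where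
  "diff_power \<delta> h i = (diff_mult \<delta> h ^^ i) [:1:]"

definition mod_r :: "('d::division_ring \<Rightarrow> 'd) \<Rightarrow> 'd poly \<Rightarrow> 'd poly \<Rightarrow> 'd poly" where
  "mod_r \<delta> h f =
     (THE r. (r = 0 \<or> degree r < degree f) \<and> (\<exists>q. h = diff_mult \<delta> q f + r))"

definition V_pow :: "('d::division_ring \<Rightarrow> 'd) \<Rightarrow> nat \<Rightarrow> 'd \<Rightarrow> 'd" where
  "V_pow \<delta> q b = (THE v. diff_power \<delta> [:-b, 1:] q = monom 1 q - [:v:])"

definition petit_carrier :: "'d::division_ring poly \<Rightarrow> 'd poly set" where
  "petit_carrier f = {h. degree h < degree f}"

definition petit_mult ::
  "('d::division_ring \<Rightarrow> 'd) \<Rightarrow> 'd poly \<Rightarrow> 'd poly \<Rightarrow> 'd poly \<Rightarrow> 'd poly" where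
  "petit_mult \<delta> f h k = mod_r \<delta> (diff_mult \<delta> h k) f"

definition petit_aut ::
  "'d::division_ring set \<Rightarrow> ('d \<Rightarrow> 'd) \<Rightarrow> 'd poly \<Rightarrow> ('d poly \<Rightarrow> 'd poly) monoid" where
  "petit_aut F \<delta> f = (BijGroup (petit_carrier f))
     \<lparr>carrier := {\<phi> \<in> Bij (petit_carrier f).
        (\<forall>h\<in>petit_carrier f. \<forall>k\<in>petit_carrier f. \<phi> (h + k) = \<phi> h + \<phi> k) \<and>
        (\<forall>c\<in>F. \<forall>h\<in>petit_carrier f. \<phi> (lsmult c h) = lsmult c (\<phi> h)) \<and>
        (\<forall>h\<in>petit_carrier f. \<forall>k\<in>petit_carrier f.
           \<phi> (petit_mult \<delta> f h k) = petit_mult \<delta> f (\<phi> h) (\<phi> k))}\<rparr>"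

definition G_id :: "('d::division_ring \<Rightarrow> 'd) \<Rightarrow> 'd \<Rightarrow> 'd poly \<Rightarrow> 'd poly" where
  "G_id \<delta> b h = (\<Sum>i\<le>degree h. lsmult (coeff h i) (diff_power \<delta> [:b, 1:] i))"

definition add_group_on :: "'d::ab_group_add set \<Rightarrow> 'd monoid" where
  "add_group_on A = \<lparr>carrier = A, mult = (+), one = 0\<rparr>"

end

theory Submission
  imports Defs
begin

text \<open>
  Write \<open>G\<^sub>b\<close> for \<open>G_id \<delta> b\<close>. A derivation-compatible operator \<open>X\<close> on a \<open>D\<close>-module turns it into a
  \<open>D[t;\<delta>]\<close>-module, and adding a central scalar \<open>b\<close> to \<open>X\<close> amounts to twisting the action by \<open>G\<^sub>b\<close>.
  Hence \<open>G\<^sub>b\<close> is a ring automorphism and \<open>G\<^sub>b G\<^sub>c = G\<^sub>b\<^sub>+\<^sub>c\<close>. Since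
  \<open>(t - a)\<^sup>m = \<Sum> (m choose k) (\<delta> - a)\<^sup>k(1) t\<^sup>m\<^sup>-\<^sup>k\<close>, in characteristic \<open>p\<close> one gets
  \<open>V\<^sub>q(a) = -(\<delta> - a)\<^sup>q(1)\<close> for \<open>q = p\<^sup>j\<close>, so \<open>G\<^sub>-\<^sub>a(f) = f - V(a)\<close>, and \<open>G\<^sub>-\<^sub>a\<close> descends to \<open>S\<^sub>f\<close> if
  \<open>V(a) = 0\<close>. On \<open>C\<close> the operator \<open>g(\<delta> - a)\<close> is multiplication by \<open>-V(a)\<close>; it kills every \<open>c\<close> with
  \<open>\<delta>(c) = a c\<close>, and if it vanishes, then minimality of \<open>g\<close> produces such a \<open>c \<noteq> 0\<close>.
\<close>

section \<open>The centre of a ring\<close>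

text \<open>Stands for the field C embedded in D: \<open>central\<close> equates the two sets, so
  the whole argument can take place inside D.\<close>

definition ring_center :: "'d::ring set" where
  "ring_center = {z. \<forall>x. z * x = x * z}"

lemma center_commute: "z \<in> ring_center \<Longrightarrow> z * x = x * z"
  by (simp add: ring_center_def)

lemma center_0 [simp]: "0 \<in> ring_center"
  by (simp add: ring_center_def)

lemma center_1 [simp]: "(1::'d::ring_1) \<in> ring_center"
  by (simp add: ring_center_def)

lemma center_add: "x \<in> ring_center \<Longrightarrow> y \<in> ring_center \<Longrightarrow> x + y \<in> ring_center"
  by (simp add: ring_center_def distrib_left distrib_right)

lemma center_minus: "x \<in> ring_center \<Longrightarrow> - x \<in> ring_center"
  by (simp add: ring_center_def)

lemma center_mult: "x \<in> ring_center \<Longrightarrow> y \<in> ring_center \<Longrightarrow> x * y \<in> ring_center"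
proof -
  assume x: "x \<in> ring_center" and y: "y \<in> ring_center"
  have "x * y * z = z * (x * y)" for z
    using center_commute[OF x, of z] center_commute[OF y, of z]
    by (simp add: mult.assoc) (simp flip: mult.assoc)
  then show ?thesis
    by (simp add: ring_center_def)
qed

lemma center_sum: "(\<And>i. i \<in> A \<Longrightarrow> u i \<in> ring_center) \<Longrightarrow> (\<Sum>i\<in>A. u i) \<in> ring_center"
  by (induction A rule: infinite_finite_induct) (simp_all add: center_add)

lemma center_inverse:
  fixes z :: "'d::division_ring"
  assumes "z \<in> ring_center"
  shows "inverse z \<in> ring_center"
proof (cases "z = 0")
  case False
  have "inverse z * x = x * inverse z" for x
  proof -
    have "z * (inverse z * x) = x"
      using False by (simp flip: mult.assoc)
    moreover have "z * (x * inverse z) = x"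
      using False center_commute[OF assms, of "x * inverse z"] by (simp add: mult.assoc)
    ultimately show ?thesis
      using False by (metis mult_left_cancel)
  qed
  then show ?thesis by (simp add: ring_center_def)
qed simp

section \<open>Evaluation of differential polynomials\<close>

text \<open>The action on \<open>m\<close> when \<open>s\<close> is the scalar action of D and t
  acts as \<open>X\<close>. Products in D[t;\<delta>], the maps \<open>G_id\<close> and differential
  operators on D are all instances.\<close>

definition diff_eval ::
  "('d::zero \<Rightarrow> 'm::comm_monoid_add \<Rightarrow> 'm) \<Rightarrow> ('m \<Rightarrow> 'm) \<Rightarrow> 'd poly \<Rightarrow> 'm \<Rightarrow> 'm" where
  "diff_eval s X h m = (\<Sum>i\<le>degree h. s (coeff h i) ((X ^^ i) m))"

lemma diff_mult_eq_diff_eval: "diff_mult \<delta> = diff_eval lsmult (t_mult \<delta>)"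
  by (intro ext) (simp add: diff_mult_def diff_eval_def)

lemma G_id_eq_diff_eval: "G_id \<delta> b h = diff_eval lsmult (diff_mult \<delta> [:b, 1:]) h [:1:]"
  by (simp add: G_id_def diff_eval_def diff_power_def)

lemma coeff_lsmult [simp]: "coeff (lsmult c h) i = c * coeff h i"
  by (simp add: lsmult_def coeff_map_poly)

lemma degree_lsmult_le: "degree (lsmult c h) \<le> degree h"
  by (intro degree_le) (simp add: coeff_eq_0)

lemma lsmult_pCons: "lsmult c (pCons a h) = pCons (c * a) (lsmult c h)"
  by (simp add: lsmult_def map_poly_pCons)

lemma lsmult_monom: "lsmult c (monom a i) = monom (c * a) i"
  by (intro poly_eqI) simp

text \<open>If p did not divide the binomial, q = p^j would be coprime to it, and k (q choose k) = q
  (q-1 choose k-1) would force q to divide k, although 0 < k < q.\<close>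

lemma of_nat_prime_power_choose_eq_0:
  assumes "prime p" "of_nat p = (0::'d::ring_1)" "0 < k" "k < p ^ j"
  shows "of_nat (p ^ j choose k) = (0::'d)"
proof -
  have "p dvd (p ^ j choose k)"
  proof (rule ccontr)
    assume "\<not> p dvd (p ^ j choose k)"
    then have "coprime (p ^ j) (p ^ j choose k)"
      using \<open>prime p\<close> by (simp add: prime_imp_coprime)
    moreover have "k * (p ^ j choose k) = p ^ j * ((p ^ j - 1) choose (k - 1))"
      using \<open>0 < k\<close> by (rule times_binomial_minus1_eq)
    ultimately have "p ^ j dvd k"
      by (metis coprime_dvd_mult_left_iff dvd_triv_left)
    with \<open>0 < k\<close> \<open>k < p ^ j\<close> show False
      by (auto dest: dvd_imp_le)
  qed
  then show ?thesis
    using assms(2) by (auto simp: dvd_def)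
qed

lemma group_add_group_on:
  assumes "0 \<in> A" "\<And>x y. x \<in> A \<Longrightarrow> y \<in> A \<Longrightarrow> x + y \<in> A" "\<And>x. x \<in> A \<Longrightarrow> - x \<in> A"
  shows "group (add_group_on A)"
  using assms by (intro groupI) (auto simp: add_group_on_def add.assoc intro: bexI[of _ "- _"])

section \<open>Derivations\<close>

locale diff_poly_ring =
  fixes \<delta> :: "'d::division_ring \<Rightarrow> 'd"
  assumes derivation: "derivation \<delta>"
begin

lemma delta_add: "\<delta> (x + y) = \<delta> x + \<delta> y"
  and delta_mult: "\<delta> (x * y) = \<delta> x * y + x * \<delta> y"
  using derivation by (simp_all add: derivation_def)

lemma delta_0 [simp]: "\<delta> 0 = 0"
  using delta_add[of 0 0] by simp

lemma delta_1 [simp]: "\<delta> 1 = 0"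
  using delta_mult[of 1 1] by simp

lemma delta_minus: "\<delta> (- x) = - \<delta> x"
  using delta_add[of x "- x"] by (simp add: eq_neg_iff_add_eq_0 add.commute)

lemma delta_sum: "\<delta> (\<Sum>i\<in>A. u i) = (\<Sum>i\<in>A. \<delta> (u i))"
  by (induction A rule: infinite_finite_induct) (simp_all add: delta_add)

lemma delta_of_nat [simp]: "\<delta> (of_nat k) = 0"
  by (induction k) (simp_all add: delta_add)

lemma delta_center: "z \<in> ring_center \<Longrightarrow> \<delta> z \<in> ring_center"
  unfolding ring_center_def
proof safe
  fix x assume z: "\<forall>x. z * x = x * z"
  then have "\<delta> (z * x) = \<delta> (x * z)" "z * \<delta> x = \<delta> x * z" by simp_all
  then show "\<delta> z * x = x * \<delta> z"
    by (simp add: delta_mult add.commute)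
qed

lemma coeff_t_mult: "coeff (t_mult \<delta> h) i = (case i of 0 \<Rightarrow> 0 | Suc j \<Rightarrow> coeff h j) + \<delta> (coeff h i)"
  by (simp add: t_mult_def coeff_map_poly coeff_pCons)

lemma t_mult_monom: "t_mult \<delta> (monom a i) = monom a (Suc i) + monom (\<delta> a) i"
  by (intro poly_eqI) (auto simp: coeff_t_mult split: nat.split)

lemma t_mult_power_one: "(t_mult \<delta> ^^ i) [:1:] = monom 1 i"
  by (induction i) (simp_all add: t_mult_monom monom_0)

end

section \<open>Modules over D[t;\<delta>]\<close>

text \<open>The rule \<open>X_s\<close> is the relation t c = c t + \<delta>(c), so these are the
  left D[t;\<delta>]-modules with t acting as \<open>X\<close>.\<close>

locale diff_module = diff_poly_ring \<delta>
  for \<delta> :: "'d::division_ring \<Rightarrow> 'd" +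
  fixes s :: "'d \<Rightarrow> 'm::ab_group_add \<Rightarrow> 'm" and X :: "'m \<Rightarrow> 'm"
  assumes s_add_left: "s (a + b) m = s a m + s b m"
    and s_add_right: "s a (m + m') = s a m + s a m'"
    and s_mult: "s (a * b) m = s a (s b m)"
    and s_one: "s 1 m = m"
    and X_add: "X (m + m') = X m + X m'"
    and X_s: "X (s c m) = s c (X m) + s (\<delta> c) m"
begin

lemma s_0_left [simp]: "s 0 m = 0"
  using s_add_left[of 0 0 m] by simp

lemma s_0_right [simp]: "s a 0 = 0"
  using s_add_right[of a 0 0] by simp

lemma X_0 [simp]: "X 0 = 0"
  using X_add[of 0 0] by simp

lemma X_sum: "X (\<Sum>i\<in>A. u i) = (\<Sum>i\<in>A. X (u i))"
  by (induction A rule: infinite_finite_induct) (simp_all add: X_add)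

lemma s_sum_right: "s c (\<Sum>i\<in>A. u i) = (\<Sum>i\<in>A. s c (u i))"
  by (induction A rule: infinite_finite_induct) (simp_all add: s_add_right)

lemma diff_eval_eq_sum:
  assumes "degree h \<le> N"
  shows "diff_eval s X h m = (\<Sum>i\<le>N. s (coeff h i) ((X ^^ i) m))"
  unfolding diff_eval_def using assms
  by (intro sum.mono_neutral_left) (auto simp: coeff_eq_0)

lemma diff_eval_0 [simp]: "diff_eval s X 0 m = 0"
  by (simp add: diff_eval_def)

text \<open>\<open>pCons a h\<close> is a + h t with the coefficients on the left, so t acts before
  \<open>h\<close>.\<close>

lemma diff_eval_pCons: "diff_eval s X (pCons a h) m = s a m + diff_eval s X h (X m)"
proof -
  have "diff_eval s X (pCons a h) m = (\<Sum>i\<le>Suc (degree h). s (coeff (pCons a h) i) ((X ^^ i) m))"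
    by (rule diff_eval_eq_sum) (simp add: degree_pCons_le)
  also have "\<dots> = s a m + diff_eval s X h (X m)"
    by (simp add: sum.atMost_Suc_shift diff_eval_def funpow_swap1 del: sum.atMost_Suc)
  finally show ?thesis .
qed

lemma diff_eval_add_left: "diff_eval s X (h + k) m = diff_eval s X h m + diff_eval s X k m"
proof -
  define N where "N = max (degree h) (degree k)"
  have "degree (h + k) \<le> N" "degree h \<le> N" "degree k \<le> N"
    by (auto simp: N_def degree_add_le_max)
  then show ?thesis
    by (simp add: diff_eval_eq_sum s_add_left sum.distrib)
qed

lemma diff_eval_minus_left: "diff_eval s X (- h) m = - diff_eval s X h m"
  using diff_eval_add_left[of h "- h" m] by (simp add: eq_neg_iff_add_eq_0 add.commute)

lemma diff_eval_diff_left: "diff_eval s X (h - k) m = diff_eval s X h m - diff_eval s X k m"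
  using diff_eval_add_left[of h "- k" m] by (simp add: diff_eval_minus_left)

lemma diff_eval_sum_left: "diff_eval s X (\<Sum>i\<in>A. u i) m = (\<Sum>i\<in>A. diff_eval s X (u i) m)"
  by (induction A rule: infinite_finite_induct) (simp_all add: diff_eval_add_left)

lemma diff_eval_lsmult: "diff_eval s X (lsmult c h) m = s c (diff_eval s X h m)"
  unfolding diff_eval_eq_sum[OF degree_lsmult_le] by (simp add: diff_eval_def s_mult s_sum_right)

lemma diff_eval_monom: "diff_eval s X (monom a i) m = s a ((X ^^ i) m)"
  by (induction i arbitrary: m) (simp_all add: monom_0 monom_Suc diff_eval_pCons funpow_swap1)

lemma diff_eval_p_polynomial:
  "diff_eval s X (monom 1 k + (\<Sum>i\<in>A. monom (u i) (w i))) m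
    = (X ^^ k) m + (\<Sum>i\<in>A. s (u i) ((X ^^ w i) m))"
  by (simp add: diff_eval_add_left diff_eval_sum_left diff_eval_monom s_one)

text \<open>Moving \<open>X\<close> past a coefficient costs its derivative, so the commutator of
  \<open>X\<close> with the operator of \<open>h\<close> is the operator with differentiated
  coefficients.\<close>

lemma X_diff_eval:
  "X (diff_eval s X h m) = diff_eval s X h (X m) + diff_eval s X (map_poly \<delta> h) m"
proof -
  have "degree (map_poly \<delta> h) \<le> degree h"
    by (intro degree_le) (simp add: coeff_map_poly coeff_eq_0)
  then show ?thesis
    by (simp add: diff_eval_eq_sum[of "map_poly \<delta> h" "degree h"] diff_eval_def[of _ _ h]
        X_sum X_s sum.distrib coeff_map_poly funpow_swap1)
qed

lemma diff_eval_t_mult: "diff_eval s X (t_mult \<delta> h) m = X (diff_eval s X h m)"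
  by (simp add: t_mult_def diff_eval_add_left diff_eval_pCons X_diff_eval)

text \<open>Typical grids are \<open>a i j = \<delta>\<^sup>i(c) X\<^sup>j(y)\<close> and \<open>a i j = (\<delta> + b)\<^sup>i(1) t\<^sup>j\<close>.\<close>

lemma X_power_grid:
  assumes grid: "\<And>i j. X (a i j) = a i (Suc j) + a (Suc i) j"
  shows "(X ^^ m) (a 0 0) = (\<Sum>k\<le>m. s (of_nat (m choose k)) (a k (m - k)))"
proof (induction m)
  case 0
  then show ?case by (simp add: s_one)
next
  case (Suc m)
  \<comment> \<open>The added term k = m + 1 has binomial coefficient 0; splitting off k = 0 then
    aligns this sum with the other one for Pascal's rule.\<close>
  have "(\<Sum>k\<le>m. s (of_nat (m choose k)) (a k (Suc (m - k))))
      = (\<Sum>k\<le>Suc m. s (of_nat (m choose k)) (a k (Suc m - k)))"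
    by (simp add: binomial_eq_0 Suc_diff_le)
  also have "\<dots> = a 0 (Suc m) + (\<Sum>k\<le>m. s (of_nat (m choose Suc k)) (a (Suc k) (m - k)))"
    by (simp add: sum.atMost_Suc_shift s_one del: sum.atMost_Suc)
  finally have shift: "(\<Sum>k\<le>m. s (of_nat (m choose k)) (a k (Suc (m - k)))) = \<dots>" .
  have "(X ^^ Suc m) (a 0 0) = (\<Sum>k\<le>m. s (of_nat (m choose k)) (a k (Suc (m - k))))
      + (\<Sum>k\<le>m. s (of_nat (m choose k)) (a (Suc k) (m - k)))"
    by (simp add: Suc.IH X_sum X_s grid s_add_right sum.distrib)
  also have "\<dots> = (\<Sum>k\<le>Suc m. s (of_nat (Suc m choose k)) (a k (Suc m - k)))"
    unfolding shift
    by (simp add: sum.atMost_Suc_shift s_one s_add_left sum.distrib add_ac del: sum.atMost_Suc)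
  finally show ?case .
qed

text \<open>For 0 < k < p^j the binomial coefficients vanish in D, so only the two ends of the
  expansion remain.\<close>

lemma X_prime_power_grid:
  assumes "prime p" "of_nat p = (0::'d)" "\<And>i j. X (a i j) = a i (Suc j) + a (Suc i) j"
  shows "(X ^^ (p ^ j)) (a 0 0) = a 0 (p ^ j) + a (p ^ j) 0"
proof -
  have pos: "0 < p ^ j"
    using \<open>prime p\<close> by (simp add: prime_gt_0_nat)
  have "(X ^^ (p ^ j)) (a 0 0) = (\<Sum>k\<le>p ^ j. s (of_nat (p ^ j choose k)) (a k (p ^ j - k)))"
    using assms(3) by (rule X_power_grid)
  also have "\<dots> = (\<Sum>k\<in>{0, p ^ j}. s (of_nat (p ^ j choose k)) (a k (p ^ j - k)))"
    by (rule sum.mono_neutral_right)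
      (auto simp: of_nat_prime_power_choose_eq_0[OF assms(1,2)])
  also have "\<dots> = a 0 (p ^ j) + a (p ^ j) 0"
    using pos by (simp add: s_one)
  finally show ?thesis .
qed

text \<open>In the grid \<delta>^i(c) X^j(y) only the ends survive: with q = p^j, the q-th power of
  \<open>X\<close> obeys the module rule relative to the q-th power of \<delta>.\<close>

lemma X_prime_power_s:
  assumes "prime p" "of_nat p = (0::'d)"
  shows "(X ^^ (p ^ j)) (s c y) = s c ((X ^^ (p ^ j)) y) + s ((\<delta> ^^ (p ^ j)) c) y"
  using X_prime_power_grid[OF assms, of "\<lambda>i j. s ((\<delta> ^^ i) c) ((X ^^ j) y)"]
  by (simp add: X_s)

text \<open>A central \<open>b\<close> commutes with all scalars, so adding it leaves the rule
  \<open>X_s\<close> intact. This produces the operators \<delta> - a and t + b.\<close>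

lemma diff_module_shift:
  assumes "b \<in> ring_center"
  shows "diff_module \<delta> s (\<lambda>m. X m + s b m)"
proof
  fix c m
  have "s b (s c m) = s c (s b m)"
    using assms by (simp add: ring_center_def flip: s_mult)
  then show "X (s c m) + s b (s c m) = s c (X m + s b m) + s (\<delta> c) m"
    by (simp add: X_s s_add_right add_ac)
qed (simp_all add: s_add_left s_add_right s_mult s_one X_add add_ac)

end

section \<open>D[t;\<delta>] and D as modules\<close>

context diff_poly_ring
begin

lemma diff_module_poly: "diff_module \<delta> lsmult (t_mult \<delta>)"
proof
  fix c :: 'd and h :: "'d poly"
  show "t_mult \<delta> (lsmult c h) = lsmult c (t_mult \<delta> h) + lsmult (\<delta> c) h"
    by (intro poly_eqI) (auto simp: coeff_t_mult delta_mult distrib_left split: nat.split)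
qed (intro poly_eqI; auto simp: coeff_t_mult delta_add algebra_simps split: nat.split)+

lemma diff_module_ring: "diff_module \<delta> (*) \<delta>"
  by unfold_locales (simp_all add: algebra_simps delta_add delta_mult)

text \<open>Two modules carry the argument: \<open>poly\<close> is D[t;\<delta>] acting on itself
  from the left, \<open>ring\<close> is D with t acting as \<delta>.\<close>

sublocale poly: diff_module \<delta> lsmult "t_mult \<delta>"
  by (rule diff_module_poly)

sublocale ring: diff_module \<delta> "(*)" \<delta>
  by (rule diff_module_ring)

lemma diff_mult_linear: "diff_mult \<delta> [:b, 1:] = (\<lambda>h. t_mult \<delta> h + lsmult b h)"
  by (intro ext)
    (simp add: diff_mult_eq_diff_eval poly.diff_eval_pCons poly.s_one add.commute)

lemma diff_module_linear:
  "b \<in> ring_center \<Longrightarrow> diff_module \<delta> lsmult (diff_mult \<delta> [:b, 1:])"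
  unfolding diff_mult_linear by (rule poly.diff_module_shift)

lemma diff_mult_one_right: "diff_mult \<delta> h [:1:] = h"
  by (simp add: diff_mult_def t_mult_power_one lsmult_monom poly_as_sum_of_monoms)

lemma G_id_0: "G_id \<delta> 0 h = h"
  using diff_mult_one_right[of h]
  unfolding G_id_eq_diff_eval diff_mult_linear by (simp add: diff_mult_eq_diff_eval)

end

context diff_module
begin

text \<open>Since (a + h t) k = a k + h (t k), the induction hypothesis is applied to t k in place
  of \<open>k\<close>. For the module \<open>poly\<close> the result is associativity.\<close>

lemma diff_eval_diff_mult:
  "diff_eval s X (diff_mult \<delta> h k) m = diff_eval s X h (diff_eval s X k m)"
proof (induction h arbitrary: k)
  case 0
  then show ?case by (simp add: diff_mult_eq_diff_eval)
next
  case (pCons a h)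
  have "diff_mult \<delta> (pCons a h) k = lsmult a k + diff_mult \<delta> h (t_mult \<delta> k)"
    by (simp add: diff_mult_eq_diff_eval poly.diff_eval_pCons)
  then show ?case
    by (simp add: diff_eval_add_left diff_eval_lsmult pCons.IH diff_eval_t_mult diff_eval_pCons)
qed

text \<open>By multiplicativity (t + b)^i acts as the i-th power of X + b, so substituting t + b in
  the polynomial amounts to shifting the operator.\<close>

lemma diff_eval_G_id:
  "diff_eval s X (G_id \<delta> b h) m = diff_eval s (\<lambda>m. X m + s b m) h m"
proof -
  have "diff_eval s X (diff_power \<delta> [:b, 1:] i) m = ((\<lambda>m. X m + s b m) ^^ i) m" for i
  proof (induction i)
    case 0
    then show ?case by (simp add: diff_power_def diff_eval_pCons s_one)
  next
    case (Suc i)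
    then show ?case
      by (simp add: diff_power_def diff_eval_diff_mult diff_eval_pCons s_one add.commute)
  qed
  then show ?thesis
    by (simp add: G_id_def diff_eval_sum_left diff_eval_lsmult diff_eval_def[of s _ h])
qed

end

section \<open>The substitutions of t + b for t\<close>

context diff_poly_ring
begin

text \<open>Both sides are the action of \<open>h\<close> on G_b(k) when t acts as left
  multiplication by t + b.\<close>

lemma G_id_diff_mult:
  assumes "b \<in> ring_center"
  shows "G_id \<delta> b (diff_mult \<delta> h k) = diff_mult \<delta> (G_id \<delta> b h) (G_id \<delta> b k)"
proof -
  interpret X: diff_module \<delta> lsmult "diff_mult \<delta> [:b, 1:]"
    using assms by (rule diff_module_linear)
  have "diff_mult \<delta> (G_id \<delta> b h) (G_id \<delta> b k)
      = diff_eval lsmult (diff_mult \<delta> [:b, 1:]) h (G_id \<delta> b k)"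
    by (simp add: diff_mult_eq_diff_eval[of \<delta>] poly.diff_eval_G_id flip: diff_mult_linear)
  also have "\<dots> = G_id \<delta> b (diff_mult \<delta> h k)"
    by (simp add: G_id_eq_diff_eval X.diff_eval_diff_mult)
  finally show ?thesis ..
qed

text \<open>Shifting left multiplication by t + b by a further b' gives left multiplication by t +
  (b + b').\<close>

lemma G_id_G_id:
  assumes "b \<in> ring_center"
  shows "G_id \<delta> b (G_id \<delta> b' h) = G_id \<delta> (b + b') h"
proof -
  interpret X: diff_module \<delta> lsmult "diff_mult \<delta> [:b, 1:]"
    using assms by (rule diff_module_linear)
  have "(\<lambda>m. diff_mult \<delta> [:b, 1:] m + lsmult b' m) = diff_mult \<delta> [:b + b', 1:]"
    by (simp add: diff_mult_linear poly.s_add_left add.assoc)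
  then show ?thesis
    by (simp add: G_id_eq_diff_eval[of \<delta> b] G_id_eq_diff_eval[of \<delta> "b + b'"] X.diff_eval_G_id)
qed

lemma
  assumes "b \<in> ring_center"
  shows G_id_add: "G_id \<delta> b (h + k) = G_id \<delta> b h + G_id \<delta> b k"
    and G_id_diff: "G_id \<delta> b (h - k) = G_id \<delta> b h - G_id \<delta> b k"
    and G_id_sum: "G_id \<delta> b (\<Sum>i\<in>A. u i) = (\<Sum>i\<in>A. G_id \<delta> b (u i))"
    and G_id_lsmult: "G_id \<delta> b (lsmult c h) = lsmult c (G_id \<delta> b h)"
    and G_id_monom: "G_id \<delta> b (monom c i) = lsmult c (diff_power \<delta> [:b, 1:] i)"
proof -
  interpret X: diff_module \<delta> lsmult "diff_mult \<delta> [:b, 1:]"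
    using assms by (rule diff_module_linear)
  show "G_id \<delta> b (h + k) = G_id \<delta> b h + G_id \<delta> b k"
    "G_id \<delta> b (h - k) = G_id \<delta> b h - G_id \<delta> b k"
    "G_id \<delta> b (\<Sum>i\<in>A. u i) = (\<Sum>i\<in>A. G_id \<delta> b (u i))"
    "G_id \<delta> b (lsmult c h) = lsmult c (G_id \<delta> b h)"
    "G_id \<delta> b (monom c i) = lsmult c (diff_power \<delta> [:b, 1:] i)"
    by (simp_all add: G_id_eq_diff_eval X.diff_eval_add_left X.diff_eval_diff_left
        X.diff_eval_sum_left X.diff_eval_lsmult X.diff_eval_monom diff_power_def)
qed


lemma G_id_const: "b \<in> ring_center \<Longrightarrow> G_id \<delta> b [:c:] = [:c:]"
  by (simp add: G_id_def diff_power_def lsmult_pCons)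

lemma degree_t_mult_le: "degree (t_mult \<delta> h) \<le> Suc (degree h)"
  by (intro degree_le) (auto simp: coeff_t_mult coeff_eq_0 split: nat.split)

lemma degree_diff_power_linear: "degree (diff_power \<delta> [:b, 1:] i) \<le> i"
proof (induction i)
  case (Suc i)
  define h where "h = diff_power \<delta> [:b, 1:] i"
  have "degree h \<le> i" using Suc by (simp add: h_def)
  have "diff_power \<delta> [:b, 1:] (Suc i) = t_mult \<delta> h + lsmult b h"
    by (simp add: h_def diff_power_def fun_cong[OF diff_mult_linear])
  moreover have "degree (t_mult \<delta> h) \<le> Suc i" "degree (lsmult b h) \<le> Suc i"
    using degree_t_mult_le[of h] degree_lsmult_le[of b h] \<open>degree h \<le> i\<close> by simp_all
  ultimately show ?case by (simp add: degree_add_le)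
qed (simp add: diff_power_def)

lemma degree_G_id_le: "degree (G_id \<delta> b h) \<le> degree h"
  unfolding G_id_def
proof (intro degree_sum_le)
  fix i assume "i \<in> {..degree h}"
  then show "degree (lsmult (coeff h i) (diff_power \<delta> [:b, 1:] i)) \<le> degree h"
    using degree_lsmult_le[of "coeff h i" "diff_power \<delta> [:b, 1:] i"] degree_diff_power_linear[of b i]
    by simp
qed simp

text \<open>Only addition, multiplication and \<delta> are applied to central elements, and all
  three preserve the centre. This keeps operator relations over C.\<close>

lemma coeff_G_id_center:
  assumes "b \<in> ring_center" "\<And>i. coeff h i \<in> ring_center"
  shows "coeff (G_id \<delta> b h) i \<in> ring_center"
proof -
  have "coeff (diff_power \<delta> [:b, 1:] j) k \<in> ring_center" for j k
  proof (induction j arbitrary: k)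
    case 0
    then show ?case by (simp add: diff_power_def coeff_pCons split: nat.split)
  next
    case (Suc j)
    then show ?case using assms(1)
      by (auto simp: diff_power_def diff_mult_linear coeff_t_mult intro!: center_add center_mult
          delta_center split: nat.split)
  qed
  then show ?thesis
    using assms(2) by (auto simp: G_id_def coeff_sum intro!: center_sum center_mult)
qed

section \<open>Right division by a monic polynomial\<close>

lemma t_mult_monic:
  assumes "degree h = m" "coeff h m = 1"
  shows "degree (t_mult \<delta> h) = Suc m \<and> coeff (t_mult \<delta> h) (Suc m) = 1"
proof -
  have "coeff (t_mult \<delta> h) (Suc m) = 1"
    using assms by (simp add: coeff_t_mult coeff_eq_0)
  moreover from this have "Suc m \<le> degree (t_mult \<delta> h)"
    by (intro le_degree) simp
  ultimately show ?thesis
    using degree_t_mult_le[of h] assms(1) by simp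
qed

lemma t_mult_power_monic:
  assumes "lead_coeff f = 1"
  shows "degree ((t_mult \<delta> ^^ i) f) = i + degree f \<and> coeff ((t_mult \<delta> ^^ i) f) (i + degree f) = 1"
  by (induction i) (use assms in \<open>simp_all add: t_mult_monic\<close>)

text \<open>Nothing cancels at the top: t^i f is monic of degree i + deg f, so only i = deg q
  contributes to the coefficient at deg q + deg f.\<close>

lemma degree_diff_mult_monic:
  assumes "lead_coeff f = 1" "q \<noteq> 0"
  shows "degree f \<le> degree (diff_mult \<delta> q f)"
proof -
  define N where "N = degree q + degree f"
  have "coeff (diff_mult \<delta> q f) N
      = (\<Sum>i\<le>degree q. coeff q i * coeff ((t_mult \<delta> ^^ i) f) N)"
    by (simp add: diff_mult_def coeff_sum)
  also have "\<dots> = (\<Sum>i\<in>{degree q}. coeff q i * coeff ((t_mult \<delta> ^^ i) f) N)"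
    by (rule sum.mono_neutral_right)
      (auto simp: N_def t_mult_power_monic[OF assms(1)] intro!: coeff_eq_0)
  also have "\<dots> = lead_coeff q"
    by (simp add: N_def t_mult_power_monic[OF assms(1)])
  finally have "coeff (diff_mult \<delta> q f) N \<noteq> 0"
    using assms(2) by simp
  then have "N \<le> degree (diff_mult \<delta> q f)"
    by (rule le_degree)
  then show ?thesis by (simp add: N_def)
qed

lemma right_division_exists:
  assumes "lead_coeff f = 1" "0 < degree f"
  shows "\<exists>q r. h = diff_mult \<delta> q f + r \<and> degree r < degree f"
proof (induction "degree h" arbitrary: h rule: less_induct)
  case less
  show ?case
  proof (cases "degree h < degree f")
    case True
    then show ?thesis
      by (intro exI[of _ 0] exI[of _ h]) (simp add: diff_mult_eq_diff_eval)
  next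
    case False
    define i where "i = degree h - degree f"
    \<comment> \<open>The polynomial t^i f is monic of degree deg h, so this multiple of
      \<open>f\<close> has the same leading term as \<open>h\<close>.\<close>
    define q where "q = monom (lead_coeff h) i"
    have i: "i + degree f = degree h" using False by (simp add: i_def)
    have q: "diff_mult \<delta> q f = lsmult (lead_coeff h) ((t_mult \<delta> ^^ i) f)"
      by (simp add: q_def diff_mult_eq_diff_eval poly.diff_eval_monom)
    have "coeff (h - diff_mult \<delta> q f) k = 0" if "degree h \<le> k" for k
      using that t_mult_power_monic[OF assms(1), of i] unfolding i q
      by (cases "k = degree h") (auto simp: coeff_eq_0)
    \<comment> \<open>Here deg h is positive because deg f is, so the drop is strict even if the
      difference is 0.\<close>
    then have "degree (h - diff_mult \<delta> q f) < degree h"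
      by (metis False assms(2) degree_0 leading_coeff_0_iff linorder_not_le gr_zeroI)
    from less[OF this] obtain q' r where
      "h - diff_mult \<delta> q f = diff_mult \<delta> q' f + r" "degree r < degree f"
      by blast
    then have "h = diff_mult \<delta> (q + q') f + r"
      by (simp add: diff_mult_eq_diff_eval poly.diff_eval_add_left algebra_simps)
    with \<open>degree r < degree f\<close> show ?thesis by blast
  qed
qed

text \<open>The product (q - q') f = r' - r has degree below deg f, which is possible only for q =
  q'.\<close>

lemma right_remainder_unique:
  assumes "lead_coeff f = 1" "diff_mult \<delta> q f + r = diff_mult \<delta> q' f + r'"
    "degree r < degree f" "degree r' < degree f"
  shows "r = r'"
proof (rule ccontr)
  assume "r \<noteq> r'"
  have eq: "diff_mult \<delta> (q - q') f = r' - r"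
    using assms(2) by (simp add: diff_mult_eq_diff_eval poly.diff_eval_diff_left algebra_simps)
  then have "q - q' \<noteq> 0"
    using \<open>r \<noteq> r'\<close> by (auto simp: diff_mult_eq_diff_eval)
  then have "degree f \<le> degree (r' - r)"
    using degree_diff_mult_monic[OF assms(1)] eq by metis
  moreover have "degree (r' - r) < degree f"
    using assms(3,4) by (rule degree_diff_less[rotated])
  ultimately show False by simp
qed

lemma mod_r_eq:
  assumes "lead_coeff f = 1" "degree r < degree f" "h = diff_mult \<delta> q f + r"
  shows "mod_r \<delta> h f = r"
  unfolding mod_r_def
proof (rule the_equality)
  show "(r = 0 \<or> degree r < degree f) \<and> (\<exists>q. h = diff_mult \<delta> q f + r)"
    using assms by blast
  fix r' assume r': "(r' = 0 \<or> degree r' < degree f) \<and> (\<exists>q. h = diff_mult \<delta> q f + r')"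
  then have "degree r' < degree f" using assms(2) by auto
  with r' assms show "r' = r" by (metis right_remainder_unique)
qed

section \<open>The Petit algebra and its automorphisms\<close>

lemma petit_mult_carrier:
  assumes "lead_coeff f = 1" "0 < degree f"
  shows "petit_mult \<delta> f h k \<in> petit_carrier f"
  using right_division_exists[OF assms, of "diff_mult \<delta> h k"] mod_r_eq[OF assms(1)]
  by (auto simp: petit_mult_def petit_carrier_def)

text \<open>Apply G_b to h k = q f + r: as G_b fixes \<open>f\<close> and does not raise degrees,
  G_b(q) f + G_b(r) is again a division with remainder.\<close>

lemma G_id_petit_mult:
  assumes "b \<in> ring_center" "lead_coeff f = 1" "0 < degree f" "G_id \<delta> b f = f"
  shows "G_id \<delta> b (petit_mult \<delta> f h k) = petit_mult \<delta> f (G_id \<delta> b h) (G_id \<delta> b k)"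
proof -
  obtain q r where qr: "diff_mult \<delta> h k = diff_mult \<delta> q f + r" "degree r < degree f"
    using right_division_exists[OF assms(2,3)] by blast
  have "diff_mult \<delta> (G_id \<delta> b h) (G_id \<delta> b k) = G_id \<delta> b (diff_mult \<delta> q f + r)"
    using assms(1) by (simp add: qr flip: G_id_diff_mult)
  also have "\<dots> = diff_mult \<delta> (G_id \<delta> b q) f + G_id \<delta> b r"
    using assms(1,4) by (simp add: G_id_add G_id_diff_mult)
  finally have "mod_r \<delta> (diff_mult \<delta> (G_id \<delta> b h) (G_id \<delta> b k)) f = G_id \<delta> b r"
    by (intro mod_r_eq[OF assms(2)]) (use qr(2) degree_G_id_le[of b r] in auto)
  moreover have "mod_r \<delta> (diff_mult \<delta> h k) f = r"
    using qr by (intro mod_r_eq[OF assms(2)])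
  ultimately show ?thesis by (simp add: petit_mult_def)
qed

lemma add_petit_carrier:
  "h \<in> petit_carrier f \<Longrightarrow> k \<in> petit_carrier f \<Longrightarrow> h + k \<in> petit_carrier f"
  by (simp add: petit_carrier_def degree_add_less)

lemma lsmult_petit_carrier: "h \<in> petit_carrier f \<Longrightarrow> lsmult c h \<in> petit_carrier f"
  using degree_lsmult_le[of c h] by (simp add: petit_carrier_def)

lemma group_petit_aut:
  assumes f: "lead_coeff f = 1" "0 < degree f"
  shows "group (petit_aut F \<delta> f)"
proof -
  define S where "S = petit_carrier f"
  define A where "A = carrier (petit_aut F \<delta> f)"
  note closed = add_petit_carrier[of _ f, folded S_def] lsmult_petit_carrier[of _ f, folded S_def]
    petit_mult_carrier[OF f, folded S_def]
  have A: "A = {\<phi> \<in> Bij S. (\<forall>h\<in>S. \<forall>k\<in>S. \<phi> (h + k) = \<phi> h + \<phi> k) \<and>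
      (\<forall>c\<in>F. \<forall>h\<in>S. \<phi> (lsmult c h) = lsmult c (\<phi> h)) \<and>
      (\<forall>h\<in>S. \<forall>k\<in>S. \<phi> (petit_mult \<delta> f h k) = petit_mult \<delta> f (\<phi> h) (\<phi> k))}"
    by (simp add: A_def S_def petit_aut_def)
  have "subgroup A (BijGroup S)"
  proof (rule subgroup.intro)
    show "A \<subseteq> carrier (BijGroup S)"
      by (auto simp: A BijGroup_def)
    show "\<one>\<^bsub>BijGroup S\<^esub> \<in> A"
      by (simp add: A BijGroup_def id_Bij closed)
  next
    fix \<phi> \<psi> assume "\<phi> \<in> A" "\<psi> \<in> A"
    moreover from \<open>\<psi> \<in> A\<close> have "\<psi> h \<in> S" if "h \<in> S" for h
      using that Bij_imp_funcset by (fastforce simp: A)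
    ultimately show "\<phi> \<otimes>\<^bsub>BijGroup S\<^esub> \<psi> \<in> A"
      by (simp add: A BijGroup_def compose_Bij compose_eq closed)
  next
    fix \<phi> assume \<phi>: "\<phi> \<in> A"
    then have bij: "\<phi> \<in> Bij S" by (simp add: A)
    have "inv_into S \<phi> (h + k) = inv_into S \<phi> h + inv_into S \<phi> k" if "h \<in> S" "k \<in> S" for h k
      by (rule Bij_inv_into_lemma[of S \<phi> "(+)"]) (use \<phi> that in \<open>auto simp: A closed\<close>)
    moreover have "inv_into S \<phi> (petit_mult \<delta> f h k)
        = petit_mult \<delta> f (inv_into S \<phi> h) (inv_into S \<phi> k)" if "h \<in> S" "k \<in> S" for h k
      by (rule Bij_inv_into_lemma[of S \<phi> "petit_mult \<delta> f"])
        (use \<phi> that in \<open>auto simp: A closed\<close>)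
    \<comment> \<open>The lemma on inverses concerns binary operations; scaling is presented as one
      that ignores its first argument.\<close>
    moreover have "inv_into S \<phi> (lsmult c h) = lsmult c (inv_into S \<phi> h)"
      if "c \<in> F" "h \<in> S" for c h
      by (rule Bij_inv_into_lemma[of S \<phi> "\<lambda>_. lsmult c" h h])
        (use \<phi> that in \<open>auto simp: A closed\<close>)
    ultimately show "inv\<^bsub>BijGroup S\<^esub> \<phi> \<in> A"
      using bij by (simp add: A inv_BijGroup restrict_inv_into_Bij closed)
  qed
  then have "group (BijGroup S\<lparr>carrier := A\<rparr>)"
    using group_BijGroup by (rule subgroup.subgroup_is_group)
  then show ?thesis
    by (simp add: A_def S_def petit_aut_def)
qed

text \<open>The inverse is G_{-b}, and neither map raises degrees, so both preserve the
  carrier.\<close>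

lemma restrict_G_id_petit_aut:
  assumes "b \<in> ring_center" "lead_coeff f = 1" "0 < degree f" "G_id \<delta> b f = f"
  shows "restrict (G_id \<delta> b) (petit_carrier f) \<in> carrier (petit_aut F \<delta> f)"
proof -
  have mem: "G_id \<delta> c h \<in> petit_carrier f" if "h \<in> petit_carrier f" for c h
    using that degree_G_id_le[of c h] by (simp add: petit_carrier_def)
  have inv: "G_id \<delta> (- b) (G_id \<delta> b h) = h" "G_id \<delta> b (G_id \<delta> (- b) h) = h" for h
    using assms(1) by (simp_all add: G_id_G_id center_minus G_id_0)
  have "bij_betw (G_id \<delta> b) (petit_carrier f) (petit_carrier f)"
    by (rule bij_betw_byWitness[where f' = "G_id \<delta> (- b)"]) (auto simp: inv mem)
  then have "restrict (G_id \<delta> b) (petit_carrier f) \<in> Bij (petit_carrier f)"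
    by (simp add: Bij_def)
  then show ?thesis
    using assms by (simp add: petit_aut_def mem add_petit_carrier lsmult_petit_carrier
        petit_mult_carrier G_id_add G_id_lsmult G_id_petit_mult)
qed

end


section \<open>The maps V_q in characteristic p\<close>

text \<open>The operator \<delta> + b on D; for central \<open>b\<close>, its i-th power at 1 is the
  constant term of (t + b)^i.\<close>

definition shifted_derivation :: "('d::ring \<Rightarrow> 'd) \<Rightarrow> 'd \<Rightarrow> 'd \<Rightarrow> 'd" where
  "shifted_derivation \<delta> b x = \<delta> x + b * x"

locale diff_poly_ring_char = diff_poly_ring \<delta>
  for \<delta> :: "'d::division_ring \<Rightarrow> 'd" +
  fixes p :: nat
  assumes prime: "prime p" and char_p: "of_nat p = (0::'d)"
begin

lemma diff_module_shifted:
  "b \<in> ring_center \<Longrightarrow> diff_module \<delta> (*) (shifted_derivation \<delta> b)"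
  unfolding shifted_derivation_def[abs_def] by (rule ring.diff_module_shift)

text \<open>Left multiplication by t + b takes c t^j to c t^(j+1) + (\<delta>(c) + b c) t^j, so the
  monomials with coefficients (\<delta> + b)^i(1) form a grid of which only the ends
  survive.\<close>

lemma diff_power_linear_prime_power:
  assumes "b \<in> ring_center"
  shows "diff_power \<delta> [:b, 1:] (p ^ j)
    = monom 1 (p ^ j) + [:(shifted_derivation \<delta> b ^^ (p ^ j)) 1:]"
proof -
  interpret X: diff_module \<delta> lsmult "diff_mult \<delta> [:b, 1:]"
    using assms by (rule diff_module_linear)
  show ?thesis
    using X.X_prime_power_grid[OF prime char_p,
        of "\<lambda>i j. monom ((shifted_derivation \<delta> b ^^ i) 1) j" j]
    by (simp add: diff_mult_linear t_mult_monom lsmult_monom add_monom shifted_derivation_def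
        diff_power_def monom_0 add.assoc)
qed

text \<open>The constant term of (t - a)^q is -V_q(a) and determines it, which settles the definite
  description.\<close>

lemma V_pow_eq:
  assumes "a \<in> ring_center"
  shows "V_pow \<delta> (p ^ j) a = - (shifted_derivation \<delta> (- a) ^^ (p ^ j)) 1"
  unfolding V_pow_def diff_power_linear_prime_power[OF center_minus[OF assms]]
proof (rule the_equality)
  let ?w = "(shifted_derivation \<delta> (- a) ^^ (p ^ j)) 1"
  show "monom 1 (p ^ j) + [:?w:] = monom 1 (p ^ j) - [:- ?w:]"
    by simp
  fix v assume "monom 1 (p ^ j) + [:?w:] = monom 1 (p ^ j) - [:v:]"
  then have "[:?w:] = - [:v:]"
    by (metis add_left_cancel diff_conv_add_uminus)
  then show "v = - ?w" by simp
qed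

lemma diff_power_V_pow:
  assumes "a \<in> ring_center"
  shows "diff_power \<delta> [:- a, 1:] (p ^ j) = monom 1 (p ^ j) - [:V_pow \<delta> (p ^ j) a:]"
  using assms by (simp add: diff_power_linear_prime_power center_minus V_pow_eq)

text \<open>Write c as c times 1 and apply the Leibniz rule for q-th powers, with (\<delta> -
  a)^q(1) = -V_q(a).\<close>

lemma shifted_derivation_prime_power:
  assumes "a \<in> ring_center"
  shows "(shifted_derivation \<delta> (- a) ^^ (p ^ j)) c = (\<delta> ^^ (p ^ j)) c - c * V_pow \<delta> (p ^ j) a"
proof -
  interpret Y: diff_module \<delta> "(*)" "shifted_derivation \<delta> (- a)"
    using assms by (intro diff_module_shifted center_minus)
  show ?thesis
    using Y.X_prime_power_s[OF prime char_p, of j c 1] assms by (simp add: V_pow_eq)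
qed

lemma V_pow_center:
  assumes "a \<in> ring_center"
  shows "V_pow \<delta> (p ^ j) a \<in> ring_center"
proof -
  have "(shifted_derivation \<delta> (- a) ^^ k) 1 \<in> ring_center" for k
    by (induction k)
      (use assms in \<open>auto simp: shifted_derivation_def simp del: mult_minus_left
        intro!: center_add center_mult center_minus delta_center\<close>)
  then show ?thesis
    using assms by (simp add: V_pow_eq center_minus)
qed

text \<open>Apply G_{-a} G_{-b} = G_{-(a+b)} to t^q and compare constant terms.\<close>

lemma V_pow_add:
  assumes "a \<in> ring_center" "b \<in> ring_center"
  shows "V_pow \<delta> (p ^ j) (a + b) = V_pow \<delta> (p ^ j) a + V_pow \<delta> (p ^ j) b"
proof -
  note center = center_minus[OF assms(1)] center_minus[OF assms(2)]
    center_minus[OF center_add[OF assms]]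
  have "monom 1 (p ^ j) - [:V_pow \<delta> (p ^ j) (a + b):] = G_id \<delta> (- (a + b)) (monom 1 (p ^ j))"
    by (simp add: G_id_monom[OF center(3)] diff_power_V_pow center_add assms poly.s_one
        del: minus_add_distrib)
  also have "\<dots> = G_id \<delta> (- a) (G_id \<delta> (- b) (monom 1 (p ^ j)))"
    using center by (simp add: G_id_G_id)
  also have "\<dots> = monom 1 (p ^ j) - [:V_pow \<delta> (p ^ j) a:] - [:V_pow \<delta> (p ^ j) b:]"
    using center by (simp add: G_id_monom diff_power_V_pow assms poly.s_one G_id_diff G_id_const)
  finally show ?thesis
    by (simp add: algebra_simps)
qed

text \<open>Compare the two ways of evaluating \<open>(\<delta> - a)\<^sup>q\<^sup>+\<^sup>1(1)\<close> for \<open>q = p\<^sup>j\<close>.\<close>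

lemma delta_V_pow:
  assumes "a \<in> ring_center"
  shows "\<delta> (V_pow \<delta> (p ^ j) a) = (\<delta> ^^ (p ^ j)) a"
proof -
  let ?Y = "shifted_derivation \<delta> (- a)" and ?v = "V_pow \<delta> (p ^ j) a"
  have minus: "(\<delta> ^^ k) (- a) = - (\<delta> ^^ k) a" for k
    by (induction k) (simp_all add: delta_minus)
  have "?Y ((?Y ^^ (p ^ j)) 1) = (?Y ^^ (p ^ j)) (?Y 1)"
    by (simp add: funpow_swap1)
  moreover have "(?Y ^^ (p ^ j)) 1 = - ?v"
    using assms by (simp add: V_pow_eq)
  ultimately have "?Y (- ?v) = (?Y ^^ (p ^ j)) (- a)"
    by (simp add: shifted_derivation_def)
  then show ?thesis
    unfolding shifted_derivation_prime_power[OF assms]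
    by (simp add: shifted_derivation_def delta_minus minus)
qed

end

section \<open>p-polynomials with coefficients in F\<close>

locale p_polynomial = diff_poly_ring_char \<delta> p
  for \<delta> :: "'d::division_ring \<Rightarrow> 'd" and p :: nat +
  fixes \<alpha> :: "nat \<Rightarrow> 'd" and e :: nat
  assumes alpha_center: "i \<in> {1..e} \<Longrightarrow> \<alpha> i \<in> ring_center"
    and alpha_const: "i \<in> {1..e} \<Longrightarrow> \<delta> (\<alpha> i) = 0"
begin

definition g :: "'d poly" where
  "g = monom 1 (p ^ e) + (\<Sum>i=1..e. monom (\<alpha> i) (p ^ (e - i)))"

definition V :: "'d \<Rightarrow> 'd" where
  "V a = V_pow \<delta> (p ^ e) a + (\<Sum>i=1..e. \<alpha> i * V_pow \<delta> (p ^ (e - i)) a)"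

lemma power_less: "i \<in> {1..e} \<Longrightarrow> p ^ (e - i) < p ^ e"
  using prime_gt_1_nat[OF prime] by (auto intro!: power_strict_increasing)

lemma coeff_g_top: "coeff g (p ^ e) = 1"
  by (auto simp: g_def coeff_sum intro!: sum.neutral) (metis power_less atLeastAtMost_iff
      One_nat_def less_irrefl)

lemma degree_g: "degree g = p ^ e"
proof (rule antisym)
  show "degree g \<le> p ^ e"
    unfolding g_def
    by (intro degree_add_le degree_sum_le)
      (auto intro!: order.trans[OF degree_monom_le] less_imp_le[OF power_less])
  show "p ^ e \<le> degree g"
    by (intro le_degree) (simp add: coeff_g_top)
qed

text \<open>All exponents p^j are positive. Hence t is a right factor of \<open>g\<close>, from
  which elements of ker V are later recognised as logarithmic derivatives.\<close>

lemma coeff_g_0: "coeff g 0 = 0"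
  using prime by (auto simp: g_def coeff_sum intro!: sum.neutral)

lemma coeff_g_center: "coeff g i \<in> ring_center"
  unfolding g_def coeff_add coeff_sum coeff_monom
  by (intro center_add center_sum) (auto simp: alpha_center)

lemma delta_coeff_g: "\<delta> (coeff g i) = 0"
  by (auto simp: g_def coeff_sum delta_add delta_sum alpha_const intro!: sum.neutral)

lemma V_center: "a \<in> ring_center \<Longrightarrow> V a \<in> ring_center"
  unfolding V_def by (intro center_add center_sum center_mult V_pow_center alpha_center) auto

lemma V_add:
  "a \<in> ring_center \<Longrightarrow> b \<in> ring_center \<Longrightarrow> V (a + b) = V a + V b"
  by (simp add: V_def V_pow_add distrib_left sum.distrib algebra_simps)

text \<open>Each power t^(p^j) loses only the constant V_{p^j}(a); weighted by the coefficients of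
  \<open>g\<close>, these constants add up to V(a).\<close>

lemma G_id_g:
  assumes "a \<in> ring_center"
  shows "G_id \<delta> (- a) g = g - [:V a:]"
proof -
  have sub: "lsmult c (diff_power \<delta> [:- a, 1:] (p ^ j)) = monom c (p ^ j) - [:c * V_pow \<delta> (p ^ j) a:]"
    for c j
    unfolding diff_power_V_pow[OF assms]
    by (intro poly_eqI) (simp add: right_diff_distrib coeff_pCons split: nat.split)
  have const: "(\<Sum>i\<in>A. [:u i:]) = [:\<Sum>i\<in>A. u i:]" for A and u :: "nat \<Rightarrow> 'd"
    by (induction A rule: infinite_finite_induct) simp_all
  show ?thesis
    using center_minus[OF assms]
    by (simp add: g_def V_def G_id_add G_id_sum G_id_monom sub sum_subtractf const)
qed

text \<open>This is G_{-a}(g) = g - V(a) read as operators on D; the values of V_q are central, so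
  they can be moved to the left of \<open>c\<close>.\<close>

lemma diff_eval_shifted_g:
  assumes "a \<in> ring_center"
  shows "diff_eval (*) (shifted_derivation \<delta> (- a)) g c = diff_eval (*) \<delta> g c - V a * c"
proof -
  interpret Y: diff_module \<delta> "(*)" "shifted_derivation \<delta> (- a)"
    using assms by (intro diff_module_shifted center_minus)
  have "c * V_pow \<delta> (p ^ j) a = V_pow \<delta> (p ^ j) a * c" for j
    using center_commute[OF V_pow_center[OF assms]] by simp
  then show ?thesis
    unfolding g_def Y.diff_eval_p_polynomial ring.diff_eval_p_polynomial
    by (simp add: shifted_derivation_prime_power[OF assms] V_def distrib_right right_diff_distrib
        sum_subtractf sum_distrib_right mult.assoc)
qed

text \<open>Termwise \<delta>(V_q(a)) = \<delta>^q(a), and the coefficients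
  \<open>\<alpha> i\<close> are constants. Once g(\<delta>) kills C, this places the values of V in
  F.\<close>

lemma delta_V: "a \<in> ring_center \<Longrightarrow> \<delta> (V a) = diff_eval (*) \<delta> g a"
  unfolding g_def ring.diff_eval_p_polynomial
  by (simp add: V_def delta_add delta_sum delta_mult delta_V_pow alpha_const)

end

section \<open>The minimum polynomial and the kernel of V\<close>

locale p_polynomial_min = p_polynomial +
  assumes min_poly: "is_min_poly_on {a \<in> ring_center. \<delta> a = 0} ring_center \<delta> g"
begin

lemma diff_eval_g: "c \<in> ring_center \<Longrightarrow> diff_eval (*) \<delta> g c = 0"
  using min_poly by (simp add: is_min_poly_on_def Let_def diff_eval_def)

lemma V_const: "a \<in> ring_center \<Longrightarrow> \<delta> (V a) = 0"
  by (simp add: delta_V diff_eval_g)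

text \<open>The powers \<open>\<delta>\<^sup>i\<close> for \<open>i < deg g\<close> are independent not only over \<open>F\<close> but over \<open>C\<close>: the
  commutator of \<open>\<delta>\<close> with a monic relation \<open>\<Sum> c\<^sub>i \<delta>\<^sup>i\<close> is the shorter relation \<open>\<Sum> \<delta>(c\<^sub>i) \<delta>\<^sup>i\<close>.\<close>

lemma degree_annihilator_ge:
  assumes "h \<noteq> 0" "\<And>i. coeff h i \<in> ring_center"
    "\<And>c. c \<in> ring_center \<Longrightarrow> diff_eval (*) \<delta> h c = 0"
  shows "degree g \<le> degree h"
  using assms
proof (induction "degree h" arbitrary: h rule: less_induct)
  case less
  define k where "k = lsmult (inverse (lead_coeff h)) h"
  have k_lead: "coeff k (degree h) = 1"
    using less.prems(1) by (simp add: k_def)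
  then have k_degree: "degree k = degree h"
    using degree_lsmult_le[of "inverse (lead_coeff h)" h] le_degree[of k "degree h"]
    by (simp add: k_def)
  have k_center: "coeff k i \<in> ring_center" for i
    using less.prems(2) by (simp add: k_def center_mult center_inverse)
  have k_ann: "diff_eval (*) \<delta> k c = 0" if "c \<in> ring_center" for c
    using less.prems(3)[OF that] by (simp add: k_def ring.diff_eval_lsmult)
  define k' where "k' = map_poly \<delta> k"
  have coeff_k': "coeff k' i = \<delta> (coeff k i)" for i
    by (simp add: k'_def coeff_map_poly)
  show ?case
  proof (cases "k' = 0")
    \<comment> \<open>All coefficients of \<open>k\<close> lie in F here, so minimality of
      \<open>g\<close> applies directly.\<close>
    case True
    then have "\<delta> (coeff k i) = 0" for i
      by (metis coeff_0 coeff_k')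
    moreover have "k \<noteq> 0"
      using k_lead by auto
    ultimately have "degree g \<le> degree k"
      using min_poly k_center k_ann by (simp add: is_min_poly_on_def Let_def diff_eval_def)
    then show ?thesis
      by (simp add: k_degree)
  next
    case False
    have "coeff k' i = 0" if "degree h \<le> i" for i
      using that k_lead k_degree by (cases "i = degree h") (auto simp: coeff_k' coeff_eq_0)
    with False have "degree k' < degree h"
      by (metis leading_coeff_0_iff linorder_not_le)
    moreover have "diff_eval (*) \<delta> k' c = 0" if "c \<in> ring_center" for c
      using ring.X_diff_eval[of k c] k_ann[OF that] k_ann[OF delta_center[OF that]]
      by (simp add: k'_def)
    ultimately show ?thesis
      using less.hyps[of k'] False by (fastforce simp: coeff_k' delta_center k_center)
  qed
qed

text \<open>For a = \<delta>(c)/c the operator \<delta> - a kills \<open>c\<close>, hence so does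
  g(\<delta> - a), which acts on C as multiplication by -V(a). Thus V(a) c = 0.\<close>

lemma V_logarithmic_derivative:
  assumes "c \<in> ring_center" "c \<noteq> 0"
  shows "V (\<delta> c / c) = 0" "\<delta> c / c \<in> ring_center"
proof -
  define a where "a = \<delta> c / c"
  show a: "\<delta> c / c \<in> ring_center"
    using assms by (simp add: divide_inverse center_mult center_inverse delta_center)
  interpret Y: diff_module \<delta> "(*)" "shifted_derivation \<delta> (- a)"
    using a by (intro diff_module_shifted center_minus) (simp add: a_def)
  have Yc: "shifted_derivation \<delta> (- a) c = 0"
    using assms by (simp add: shifted_derivation_def a_def divide_inverse mult.assoc)
  have zero: "(shifted_derivation \<delta> (- a) ^^ p ^ j) c = 0" for j
  proof -
    obtain k where "p ^ j = Suc k"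
      using prime by (metis not0_implies_Suc power_not_zero not_prime_0)
    moreover have "(shifted_derivation \<delta> (- a) ^^ k) 0 = 0" for k
      by (induction k) simp_all
    ultimately show ?thesis
      by (simp add: funpow_Suc_right Yc del: funpow.simps)
  qed
  have "diff_eval (*) (shifted_derivation \<delta> (- a)) g c = 0"
    unfolding g_def Y.diff_eval_p_polynomial by (simp add: zero)
  then show "V (\<delta> c / c) = 0"
    using diff_eval_shifted_g[of a c] diff_eval_g[OF assms(1)] assms(2) a by (simp add: a_def)
qed

text \<open>If \<open>V a = 0\<close> then \<open>g(\<delta> - a)\<close> vanishes on \<open>C\<close>. Writing \<open>g = h t\<close>, the operator \<open>h(\<delta> - a)\<close> has
  order less than \<open>deg g\<close>, so it does not vanish on \<open>C\<close>, and its values lie in the kernel of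
  \<open>\<delta> - a\<close>.\<close>

lemma kernel_V_logarithmic_derivative:
  assumes a: "a \<in> ring_center" and "V a = 0"
  obtains c where "c \<in> ring_center" "c \<noteq> 0" "a = \<delta> c / c"
proof -
  interpret Y: diff_module \<delta> "(*)" "shifted_derivation \<delta> (- a)"
    using a by (intro diff_module_shifted center_minus)
  obtain h where g: "g = pCons 0 h"
    using coeff_g_0 by (metis coeff_pCons_0 pCons_cases)
  have coeff_h: "coeff h i = coeff g (Suc i)" for i
    by (simp add: g)
  have "g \<noteq> 0"
    using coeff_g_top by auto
  then have "h \<noteq> 0" "degree h < degree g"
    by (auto simp: g)
  \<comment> \<open>The operator h(\<delta> - a) is rewritten as the polynomial \<open>k\<close> in
    \<delta>, the form in which independence over C was shown.\<close>
  define k where "k = G_id \<delta> (- a) h"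
  have "h = G_id \<delta> a k"
    using a by (simp add: k_def G_id_G_id G_id_0)
  with \<open>h \<noteq> 0\<close> have "k \<noteq> 0"
    by (auto simp: G_id_def)
  have k_center: "coeff k i \<in> ring_center" for i
    unfolding k_def by (intro coeff_G_id_center center_minus a) (simp add: coeff_h coeff_g_center)
  have "degree k < degree g"
    using degree_G_id_le[of "- a" h] \<open>degree h < degree g\<close> by (simp add: k_def)
  then obtain y where y: "y \<in> ring_center" "diff_eval (*) \<delta> k y \<noteq> 0"
    using degree_annihilator_ge[of k] \<open>k \<noteq> 0\<close> k_center by force
  define c where "c = diff_eval (*) \<delta> k y"
  have "(\<delta> ^^ i) y \<in> ring_center" for i
    by (induction i) (simp_all add: y(1) delta_center)
  then have c_center: "c \<in> ring_center"
    unfolding c_def diff_eval_def by (intro center_sum center_mult k_center)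
  have c: "c = diff_eval (*) (shifted_derivation \<delta> (- a)) h y"
    unfolding c_def k_def ring.diff_eval_G_id by (simp add: shifted_derivation_def[abs_def])
  \<comment> \<open>The coefficients of \<open>h\<close> are constants, so \<delta> - a commutes
    with h(\<delta> - a) and the composite is g(\<delta> - a).\<close>
  have "map_poly \<delta> h = 0"
    by (intro poly_eqI) (simp add: coeff_map_poly coeff_h delta_coeff_g)
  then have "shifted_derivation \<delta> (- a) c = diff_eval (*) (shifted_derivation \<delta> (- a)) g y"
    unfolding c Y.X_diff_eval g Y.diff_eval_pCons by simp
  also have "\<dots> = 0"
    using diff_eval_shifted_g[OF a] diff_eval_g[OF y(1)] \<open>V a = 0\<close> by simp
  finally have "\<delta> c = a * c"
    by (simp add: shifted_derivation_def)
  moreover have "c \<noteq> 0" using y(2) by (simp add: c_def)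
  ultimately show thesis
    using that[OF c_center] by (simp add: divide_inverse mult.assoc)
qed

lemma kernel_V_eq:
  "{a \<in> ring_center. V a = 0} = {\<delta> c / c | c. c \<in> ring_center \<and> c \<noteq> 0}"
proof (intro equalityI subsetI)
  fix a assume "a \<in> {a \<in> ring_center. V a = 0}"
  then show "a \<in> {\<delta> c / c | c. c \<in> ring_center \<and> c \<noteq> 0}"
    using kernel_V_logarithmic_derivative[of a] by blast
next
  fix a assume "a \<in> {\<delta> c / c | c. c \<in> ring_center \<and> c \<noteq> 0}"
  then show "a \<in> {a \<in> ring_center. V a = 0}"
    using V_logarithmic_derivative by blast
qed


lemma group_hom_V:
  "group_hom (add_group_on ring_center) (add_group_on {a \<in> ring_center. \<delta> a = 0}) V"
proof (intro group_hom.intro group_hom_axioms.intro)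
  show "group (add_group_on (ring_center :: 'a set))"
    by (intro group_add_group_on) (simp_all add: center_add center_minus)
  show "group (add_group_on {a \<in> ring_center. \<delta> a = 0})"
    by (intro group_add_group_on) (simp_all add: center_add center_minus delta_add delta_minus)
  show "V \<in> hom (add_group_on ring_center) (add_group_on {a \<in> ring_center. \<delta> a = 0})"
    by (simp add: hom_def add_group_on_def V_add V_center V_const)
qed

end

section \<open>The kernel of V as a group of automorphisms\<close>

theorem proposition8:
  fixes scale :: "'c::field \<Rightarrow> 'd::division_ring \<Rightarrow> 'd"
    and \<delta> :: "'d \<Rightarrow> 'd"
    and \<alpha> :: "nat \<Rightarrow> 'd"
    and d :: 'd
    and n p e :: nat
  defines "C \<equiv> range (\<lambda>c. scale c 1)"
  defines "F \<equiv> {a \<in> C. \<delta> a = 0}"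
  defines "g \<equiv> monom 1 (p ^ e) + (\<Sum>i=1..e. monom (\<alpha> i) (p ^ (e - i)))"
  defines "V \<equiv> \<lambda>a. V_pow \<delta> (p ^ e) a + (\<Sum>i=1..e. \<alpha> i * V_pow \<delta> (p ^ (e - i)) a)"
  defines "f \<equiv> g - [:d:]"
  defines "K \<equiv> kernel (add_group_on C) (add_group_on F) V"
  defines "H \<equiv> {restrict (G_id \<delta> (- a)) (petit_carrier f) | a. a \<in> C \<and> V a = 0}"
  assumes "CHAR('c) = p" and "p > 0"
    and "central_division_algebra scale n"
    and "derivation \<delta>" and "\<exists>x. \<delta> x \<noteq> 0"
    and "\<forall>i\<in>{1..e}. \<alpha> i \<in> F"
    and "is_min_poly_on F C \<delta> g"
    and "p ^ e \<ge> 2"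
  shows "group_hom (add_group_on C) (add_group_on F) V \<and>
    (K = {a \<in> C. V a = 0}) \<and>
    (K = {\<delta> c / c | c. c \<in> C \<and> c \<noteq> 0}) \<and>
    group (petit_aut F \<delta> f) \<and>
    subgroup H (petit_aut F \<delta> f) \<and>
    (add_group_on C)\<lparr>carrier := K\<rparr> \<cong> (petit_aut F \<delta> f)\<lparr>carrier := H\<rparr>"
proof -
  interpret cda: central_division_algebra scale n by fact
  have C: "C = ring_center"
    unfolding C_def ring_center_def by (rule cda.central)
  have "prime p"
    using \<open>CHAR('c) = p\<close> \<open>p > 0\<close> prime_CHAR_semidom by blast
  \<comment> \<open>The characteristic is given for the field of scalars; this carries it over to
    D.\<close>
  moreover have "of_nat k = scale (of_nat k) (1::'d)" for k
    by (induction k) (simp_all add: cda.scale_left_distrib)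
  from this[of p] have "of_nat p = (0::'d)"
    using \<open>CHAR('c) = p\<close> by (metis cda.scale_zero_left of_nat_CHAR)
  ultimately interpret pp: p_polynomial \<delta> p \<alpha> e
    using assms by unfold_locales (auto simp: F_def C)
  have g: "g = pp.g"
    by (simp add: g_def pp.g_def)
  have V: "V = pp.V"
    by (intro ext) (simp add: V_def pp.V_def)
  interpret pp: p_polynomial_min \<delta> p \<alpha> e
    using \<open>is_min_poly_on F C \<delta> g\<close> by unfold_locales (simp add: F_def C g)

  have hom_V: "group_hom (add_group_on C) (add_group_on F) V"
    unfolding F_def C V by (rule pp.group_hom_V)
  have K: "K = {a \<in> C. V a = 0}"
    by (simp add: K_def kernel_def add_group_on_def)

  have "degree f = p ^ e" "lead_coeff f = 1"
  proof -
    have "degree [:d:] < degree pp.g"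
      using \<open>p ^ e \<ge> 2\<close> \<open>p > 0\<close> by (simp add: pp.degree_g)
    then show "degree f = p ^ e"
      unfolding f_def g diff_conv_add_uminus using degree_add_eq_left[of "- [:d:]" pp.g]
      by (simp add: pp.degree_g)
    then show "lead_coeff f = 1"
      using \<open>p > 0\<close> by (simp add: f_def g pp.coeff_g_top coeff_pCons split: nat.split)
  qed
  \<comment> \<open>The bound 1 < deg f puts t itself into S_f, where injectivity is tested.\<close>
  then have f: "lead_coeff f = 1" "0 < degree f" "1 < degree f"
    using \<open>p ^ e \<ge> 2\<close> \<open>p > 0\<close> by simp_all
  have aut: "group (petit_aut F \<delta> f)"
    using f by (intro pp.group_petit_aut)

  \<comment> \<open>Elements of \<open>Bij\<close> are extensional functions, hence the
    restriction.\<close>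
  define \<Phi> where "\<Phi> a = restrict (G_id \<delta> (- a)) (petit_carrier f)" for a
  have \<Phi>_carrier: "\<Phi> a \<in> carrier (petit_aut F \<delta> f)" if "a \<in> K" for a
  proof -
    have a: "a \<in> ring_center" "pp.V a = 0"
      using that by (simp_all add: K C V)
    \<comment> \<open>The constant \<open>d\<close> is fixed, and \<open>g\<close> changes by V(a) =
      0.\<close>
    then have "G_id \<delta> (- a) f = f"
      by (simp add: f_def g pp.G_id_diff pp.G_id_g pp.G_id_const center_minus)
    then show ?thesis
      unfolding \<Phi>_def using a f by (intro pp.restrict_G_id_petit_aut center_minus)
  qed
  have \<Phi>_add: "\<Phi> (a + b) = \<Phi> a \<otimes>\<^bsub>petit_aut F \<delta> f\<^esub> \<Phi> b" if "a \<in> K" "b \<in> K" for a b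
  proof -
    have "\<Phi> a \<in> Bij (petit_carrier f)" "\<Phi> b \<in> Bij (petit_carrier f)"
      using that[THEN \<Phi>_carrier] by (simp_all add: petit_aut_def)
    then have "\<Phi> a \<otimes>\<^bsub>petit_aut F \<delta> f\<^esub> \<Phi> b = compose (petit_carrier f) (\<Phi> a) (\<Phi> b)"
      by (simp add: petit_aut_def BijGroup_def)
    also have "\<dots> = \<Phi> (a + b)"
    proof
      fix h
      show "compose (petit_carrier f) (\<Phi> a) (\<Phi> b) h = \<Phi> (a + b) h"
        using that pp.degree_G_id_le[of "- b" h]
        by (simp add: \<Phi>_def compose_def petit_carrier_def K C pp.G_id_G_id center_minus)
    qed
    finally show ?thesis ..
  qed
  interpret hom_V: group_hom "add_group_on C" "add_group_on F" V
    by (rule hom_V)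
  have "group ((add_group_on C)\<lparr>carrier := K\<rparr>)"
    unfolding K_def using hom_V.subgroup_kernel hom_V.G.is_group
    by (rule subgroup.subgroup_is_group)
  moreover have \<Phi>_hom: "\<Phi> \<in> hom ((add_group_on C)\<lparr>carrier := K\<rparr>) (petit_aut F \<delta> f)"
    by (simp add: hom_def \<Phi>_carrier) (simp add: add_group_on_def \<Phi>_add)
  ultimately interpret \<Phi>: group_hom "(add_group_on C)\<lparr>carrier := K\<rparr>" "petit_aut F \<delta> f" \<Phi>
    using aut by (intro group_hom.intro group_hom_axioms.intro)
  have H: "H = \<Phi> ` K"
    by (auto simp: H_def \<Phi>_def K)
  have subgroup_H: "subgroup H (petit_aut F \<delta> f)"
    using \<Phi>.img_is_subgroup by (simp add: H)
  have "inj_on \<Phi> K"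
  proof (rule inj_onI)
    fix a b assume "a \<in> K" "b \<in> K" "\<Phi> a = \<Phi> b"
    \<comment> \<open>The image of t under \<Phi>(c) is t - c, which determines c.\<close>
    moreover have "monom 1 1 \<in> petit_carrier f"
      using f(3) by (simp add: petit_carrier_def degree_monom_eq)
    moreover have "G_id \<delta> (- c) (monom 1 1) = [:- c, 1:]" if "c \<in> K" for c
      using that by (simp add: K C pp.G_id_monom center_minus diff_power_def
          pp.diff_mult_one_right pp.poly.s_one)
    ultimately show "a = b"
      by (metis \<Phi>_def restrict_apply' pCons_eq_iff neg_equal_iff_equal)
  qed
  then have "\<Phi> \<in> iso ((add_group_on C)\<lparr>carrier := K\<rparr>) ((petit_aut F \<delta> f)\<lparr>carrier := H\<rparr>)"
    using \<Phi>_hom by (intro isoI) (auto simp: hom_def H bij_betw_def)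
  then have "(add_group_on C)\<lparr>carrier := K\<rparr> \<cong> (petit_aut F \<delta> f)\<lparr>carrier := H\<rparr>"
    by (rule is_isoI)
  moreover have "K = {\<delta> c / c | c. c \<in> C \<and> c \<noteq> 0}"
    unfolding K C V by (rule pp.kernel_V_eq)
  ultimately show ?thesis
    using hom_V K aut subgroup_H by blast
qed

end
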